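(* Let $T\in\mathbb{K}^a\otimes\mathbb{K}^b\otimes\mathbb{K}^c$ be a concise tensor. For every integer $k\geq c$ let $T'_k\in\mathbb{K}^{a+1}\otimes\mathbb{K}^{b+k}\otimes\mathbb{K}^{b+k}$ be the tensor $T'_k=T+e_0\otimes\mathrm{i}$ described in the context. Let $k$ be the smallest integer such that $T'_k$ has border rank $b+k$. Then $T$ has border rank at least $k$ and at most $b+k$.
   Context: $\mathbb{K}$ is an algebraically closed field of characteristic zero. The border rank of a tensor is the least $r$ such that it lies in the Zariski closure of the sums of at most $r$ tensors of the form $u\otimes v\otimes w$. A tensor is concise if it is not contained in $V_1\otimes V_2\otimes V_3$ with some $V_i$ a proper subspace of the corresponding factor. Construction of $T'_k$: let $e_1,\ldots,e_a$ be the basis of $\mathbb{K}^a$, extended by $e_0$ to a basis of $\mathbb{K}^{a+1}$. Embed $\mathbb{K}^b$ in the second factor $\mathbb{K}^{b+k}$ as the span of the first $b$ basis vectors and $\mathbb{K}^c$ in the third factor $\mathbb{K}^{b+k}$ as the span of the last $c$ basis vectors, so that $T$ is viewed in $\mathbb{K}^{a+1}\otimes\mathbb{K}^{b+k}\otimes\mathbb{K}^{b+k}$. Let $\mathrm{i}=\sum_{j=1}^{b+k}f_j\otimes f_j$ be the identity of $\mathbb{K}^{b+k}$. Equivalently, contracting $T'_k$ with $(\mathbb{K}^{b+k})^*$ in the third factor gives the space of $(a+1)\times(b+k)$ matrices whose first row is $(x_1,\ldots,x_b,y_1,\ldots,y_{k-c},z_1,\ldots,z_c)$ and whose remaining $a$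 rows are $T((\mathbb{K}^c)^* )$ (with entries linear forms in $z_1,\ldots,z_c$) in the first $b$ columns and zero in the other columns. *)

theory Defs
  imports
    "HOL-Library.Function_Algebras"
    "HOL-Computational_Algebra.Polynomial"
begin

text \<open>
  Vectors and tensors are given by their coordinates: the space \<open>K^n\<close> consists of the functions on
  \<open>nat\<close> that vanish outside \<open>{..<n}\<close>, and \<open>K^a \<otimes> K^b \<otimes> K^c\<close> of the functions on index triples that
  vanish outside the \<open>a \<times> b \<times> c\<close> box.  Indices start at \<open>0\<close>.
\<close>

definition fscale :: "'k::field \<Rightarrow> ('i \<Rightarrow> 'k) \<Rightarrow> 'i \<Rightarrow> 'k" where
  "fscale c f = (\<lambda>i. c * f i)"

interpretation fun_vs: vector_space "fscale :: 'k::field \<Rightarrow> ('i \<Rightarrow> 'k) \<Rightarrow> 'i \<Rightarrow> 'k"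
  by unfold_locales (auto simp: fscale_def fun_eq_iff algebra_simps)

type_synonym 'k tensor3 = "nat \<times> nat \<times> nat \<Rightarrow> 'k"

definition coord_space :: "nat \<Rightarrow> (nat \<Rightarrow> 'k::field) set" where
  "coord_space n = {v. \<forall>i\<ge>n. v i = 0}"

definition tensor_space :: "nat \<Rightarrow> nat \<Rightarrow> nat \<Rightarrow> 'k::field tensor3 set" where
  "tensor_space a b c = {T. \<forall>i j l. T (i, j, l) \<noteq> 0 \<longrightarrow> i < a \<and> j < b \<and> l < c}"

definition pure_tensor :: "(nat \<Rightarrow> 'k::field) \<Rightarrow> (nat \<Rightarrow> 'k) \<Rightarrow> (nat \<Rightarrow> 'k) \<Rightarrow> 'k tensor3" where
  "pure_tensor u v w = (\<lambda>(i, j, l). u i * v j * w l)"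

definition unit_vector :: "nat \<Rightarrow> nat \<Rightarrow> 'k::field" where
  "unit_vector n = (\<lambda>i. if i = n then 1 else 0)"

definition tensor_prod ::
  "(nat \<Rightarrow> 'k::field) set \<Rightarrow> (nat \<Rightarrow> 'k) set \<Rightarrow> (nat \<Rightarrow> 'k) set \<Rightarrow> 'k tensor3 set" where
  "tensor_prod V1 V2 V3 =
     fun_vs.span {pure_tensor u v w | u v w. u \<in> V1 \<and> v \<in> V2 \<and> w \<in> V3}"

definition concise :: "nat \<Rightarrow> nat \<Rightarrow> nat \<Rightarrow> 'k::field tensor3 \<Rightarrow> bool" where
  "concise a b c T \<longleftrightarrow>
     \<not> (\<exists>V1 V2 V3. fun_vs.subspace V1 \<and> fun_vs.subspace V2 \<and> fun_vs.subspace V3 \<and>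
          V1 \<subseteq> coord_space a \<and> V2 \<subseteq> coord_space b \<and> V3 \<subseteq> coord_space c \<and>
          (V1 \<noteq> coord_space a \<or> V2 \<noteq> coord_space b \<or> V3 \<noteq> coord_space c) \<and>
          T \<in> tensor_prod V1 V2 V3)"

text \<open>Functions given by polynomials in (finitely many of) the coordinates.\<close>

inductive polynomial_fun :: "(('i \<Rightarrow> 'k::field) \<Rightarrow> 'k) \<Rightarrow> bool" where
  const: "polynomial_fun (\<lambda>x. c)"
| coord: "polynomial_fun (\<lambda>x. x i)"
| add: "polynomial_fun p \<Longrightarrow> polynomial_fun q \<Longrightarrow> polynomial_fun (\<lambda>x. p x + q x)"
| mult: "polynomial_fun p \<Longrightarrow> polynomial_fun q \<Longrightarrow> polynomial_fun (\<lambda>x. p x * q x)"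

text \<open>
  For a subset \<open>X\<close> of \<open>tensor_space a b c\<close> this is the closure in that space: the coordinates outside
  the box are polynomial functions vanishing on \<open>X\<close>, hence on the closure.
\<close>

definition zariski_closure :: "('i \<Rightarrow> 'k::field) set \<Rightarrow> ('i \<Rightarrow> 'k) set" where
  "zariski_closure X =
     {x. \<forall>p. polynomial_fun p \<longrightarrow> (\<forall>y\<in>X. p y = 0) \<longrightarrow> p x = 0}"

definition rank_le_set :: "nat \<Rightarrow> nat \<Rightarrow> nat \<Rightarrow> nat \<Rightarrow> 'k::field tensor3 set" where
  "rank_le_set a b c r =
     {\<Sum>s<m. pure_tensor (u s) (v s) (w s) | m u v w.
        m \<le> r \<and> (\<forall>s<m. u s \<in> coord_space a \<and> v s \<in> coord_space b \<and> w s \<in> coord_space c)}"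

definition border_rank :: "nat \<Rightarrow> nat \<Rightarrow> nat \<Rightarrow> 'k::field tensor3 \<Rightarrow> nat" where
  "border_rank a b c T = (LEAST r. T \<in> zariski_closure (rank_le_set a b c r))"

text \<open>
  The basis vector \<open>e\<^sub>0\<close> has index \<open>0\<close> in \<open>K^(a+1)\<close>, so the first index of \<open>T\<close> is shifted by one;
  the last \<open>c\<close> basis vectors of \<open>K^(b+k)\<close> are those with index at least \<open>b + k - c\<close>.
  Meaningful for \<open>k \<ge> c\<close>.
\<close>

definition embed_tensor :: "nat \<Rightarrow> nat \<Rightarrow> nat \<Rightarrow> 'k::field tensor3 \<Rightarrow> 'k tensor3" where
  "embed_tensor b c k T =
     (\<lambda>(i, j, l). if 1 \<le> i \<and> b + k - c \<le> l then T (i - 1, j, l - (b + k - c)) else 0)"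

definition T_prime :: "nat \<Rightarrow> nat \<Rightarrow> nat \<Rightarrow> 'k::field tensor3 \<Rightarrow> 'k tensor3" where
  "T_prime b c k T =
     embed_tensor b c k T +
     (\<Sum>j<b + k. pure_tensor (unit_vector 0) (unit_vector j) (unit_vector j))"

end

theory Submission
  imports Defs "Jordan_Normal_Form.Char_Poly"
begin

text \<open>
  Contracting \<open>T'\<^sub>k\<close> with \<open>e\<^sub>0\<^sup>*\<close> gives an identity matrix, so its border rank is at least \<open>b + k\<close>, and
  \<open>T\<close> is a coordinate projection of \<open>T'\<^sub>k\<close>, so the border rank of \<open>T\<close> is at most that of \<open>T'\<^sub>k\<close>.
  It remains to see that \<open>T'\<^sub>r\<close> has border rank at most \<open>b + r\<close> for \<open>r\<close> the border rank of \<open>T\<close>, where \<open>c \<le> r\<close>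
  by conciseness.  As \<open>T'\<^sub>r\<close> depends polynomially on \<open>T\<close>, one may take
  \<open>T = \<Sum> u\<^sub>s \<otimes> v\<^sub>s \<otimes> w\<^sub>s\<close> with \<open>r\<close> summands.  Put the \<open>w\<^sub>s\<close> into \<open>K^r\<close> and perturb them to a basis;
  then an explicit one-parameter degeneration exhibits the tensor as a limit of tensors of rank \<open>b + r\<close>.
\<close>

lemma sum_fun_apply: "(\<Sum>s\<in>A. f s) x = (\<Sum>s\<in>A. f s x)"
  by (induction A rule: infinite_finite_induct) auto

lemma pure_tensor_apply [simp]: "pure_tensor u v w (i, j, l) = u i * v j * w l"
  by (simp add: pure_tensor_def)

section \<open>Polynomial functions and Zariski closure\<close>

lemma polynomial_fun_sum:
  assumes "\<And>s. s \<in> A \<Longrightarrow> polynomial_fun (f s)"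
  shows "polynomial_fun (\<lambda>x. \<Sum>s\<in>A. f s x)"
  using assms
  by (induction A rule: infinite_finite_induct) (auto intro: polynomial_fun.intros)

lemma polynomial_fun_prod:
  assumes "\<And>s. s \<in> A \<Longrightarrow> polynomial_fun (f s)"
  shows "polynomial_fun (\<lambda>x. \<Prod>s\<in>A. f s x)"
  using assms
  by (induction A rule: infinite_finite_induct) (auto intro: polynomial_fun.intros)

lemma polynomial_fun_if:
  "polynomial_fun p \<Longrightarrow> polynomial_fun q \<Longrightarrow> polynomial_fun (\<lambda>x. if P then p x else q x)"
  by (cases P) simp_all

text \<open>By the Leibniz formula. This makes the vanishing of a minor a closed condition.\<close>

lemma polynomial_fun_det:
  "polynomial_fun (\<lambda>x :: 'i \<Rightarrow> 'k::field. det (mat n n (\<lambda>(p, l). x (f p l))))"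
proof -
  have "(\<lambda>x :: 'i \<Rightarrow> 'k. det (mat n n (\<lambda>(p, l). x (f p l)))) =
    (\<lambda>x. \<Sum>\<pi> | \<pi> permutes {0..<n}. signof \<pi> * (\<Prod>p = 0..<n. x (f p (\<pi> p))))"
  proof
    fix x :: "'i \<Rightarrow> 'k"
    show "det (mat n n (\<lambda>(p, l). x (f p l))) =
      (\<Sum>\<pi> | \<pi> permutes {0..<n}. signof \<pi> * (\<Prod>p = 0..<n. x (f p (\<pi> p))))"
      by (subst det_def'[of _ n]) (auto intro!: sum.cong prod.cong)
  qed
  then show ?thesis
    by (auto intro!: polynomial_fun_sum polynomial_fun_prod polynomial_fun.intros)
qed

lemma polynomial_fun_compose:
  assumes "polynomial_fun p" and "\<And>i. polynomial_fun (\<lambda>x. \<phi> x i)"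
  shows "polynomial_fun (\<lambda>x. p (\<phi> x))"
  using assms(1) by induction (auto intro: polynomial_fun.intros assms(2))

lemma zariski_closure_superset: "X \<subseteq> zariski_closure X"
  by (auto simp: zariski_closure_def)

text \<open>A polynomial vanishing on \<open>Y\<close> pulls back along \<open>\<phi>\<close> to one
  vanishing on \<open>X\<close>. Allowing images in the closure of \<open>Y\<close> lets limits be
  iterated.\<close>

lemma zariski_closure_polynomial_map:
  assumes "\<And>i. polynomial_fun (\<lambda>x. \<phi> x i)"
    and "\<And>x. x \<in> X \<Longrightarrow> \<phi> x \<in> zariski_closure Y"
    and "x \<in> zariski_closure X"
  shows "\<phi> x \<in> zariski_closure Y"
  unfolding zariski_closure_def
proof (intro CollectI allI impI)
  fix p assume p: "polynomial_fun p" "\<forall>y\<in>Y. p y = 0"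
  have "polynomial_fun (\<lambda>x. p (\<phi> x))"
    by (rule polynomial_fun_compose[OF p(1) assms(1)])
  moreover have "\<forall>x\<in>X. p (\<phi> x) = 0"
    using assms(2) p by (auto simp: zariski_closure_def)
  ultimately show "p (\<phi> x) = 0"
    using assms(3) by (auto simp: zariski_closure_def)
qed

lemma polynomial_fun_on_line:
  assumes "polynomial_fun p"
  shows "\<exists>q. \<forall>t. p (\<lambda>i. x i + t * y i) = poly q t"
  using assms
proof induction
  case (const c)
  then show ?case by (auto intro: exI[of _ "[:c:]"])
next
  case (coord i)
  then show ?case by (auto intro: exI[of _ "[:x i, y i:]"])
next
  case (add p q)
  then show ?case by (metis poly_add)
next
  case (mult p q)
  then show ?case by (metis poly_mult)
qed

text \<open>Restricted to the line, a polynomial vanishing on \<open>X\<close> becomes univariate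
  with infinitely many roots, since a field of characteristic zero is infinite. This plays the role
  of the limit \<open>t -> 0\<close>.\<close>

lemma zariski_closure_line:
  fixes x y :: "'i \<Rightarrow> 'k::field_char_0"
  assumes "finite F"
    and "\<And>t. t \<notin> F \<Longrightarrow> (\<lambda>i. x i + t * y i) \<in> zariski_closure X"
  shows "x \<in> zariski_closure X"
  unfolding zariski_closure_def
proof (intro CollectI allI impI)
  fix p assume p: "polynomial_fun p" "\<forall>y\<in>X. p y = 0"
  obtain q where q: "\<And>t. p (\<lambda>i. x i + t * y i) = poly q t"
    using polynomial_fun_on_line[OF p(1)] by blast
  have "poly q t = 0" if "t \<notin> F" for t
    using assms(2)[OF that] p by (auto simp: zariski_closure_def q[symmetric])
  then have "- F \<subseteq> {t. poly q t = 0}"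
    by auto
  moreover have "infinite (- F)"
    using \<open>finite F\<close> infinite_UNIV_char_0 by (metis finite_compl)
  ultimately have "infinite {t. poly q t = 0}"
    using finite_subset by blast
  then have "q = 0"
    using poly_roots_finite by blast
  then show "p x = 0"
    using q[of 0] by simp
qed

section \<open>Tensor rank\<close>

lemma rank_le_setI:
  assumes "m \<le> r"
    and "\<And>s. s < m \<Longrightarrow> u s \<in> coord_space a \<and> v s \<in> coord_space b \<and> w s \<in> coord_space c"
    and "\<And>i j l. x (i, j, l) = (\<Sum>s<m. u s i * v s j * w s l)"
  shows "x \<in> rank_le_set a b c r"
proof -
  have "x = (\<Sum>s<m. pure_tensor (u s) (v s) (w s))"
    by (auto simp: fun_eq_iff sum_fun_apply assms(3))
  then show ?thesis
    using assms(1,2) unfolding rank_le_set_def by blast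
qed

text \<open>Padding with zero vectors yields exactly \<open>r\<close> summands, with membership for
  every index \<open>s\<close>.\<close>

lemma rank_le_setE:
  assumes "x \<in> rank_le_set a b c r"
  obtains u v w where "\<And>s. u s \<in> coord_space a" "\<And>s. v s \<in> coord_space b"
    "\<And>s. w s \<in> coord_space c" "\<And>i j l. x (i, j, l) = (\<Sum>s<r. u s i * v s j * w s l)"
proof -
  obtain m u v w where m: "m \<le> r" and
    mem: "\<And>s. s < m \<Longrightarrow> u s \<in> coord_space a \<and> v s \<in> coord_space b \<and> w s \<in> coord_space c"
    and x: "x = (\<Sum>s<m. pure_tensor (u s) (v s) (w s))"
    using assms unfolding rank_le_set_def by blast
  let ?pad = "\<lambda>f :: nat \<Rightarrow> nat \<Rightarrow> 'a. \<lambda>s. if s < m then f s else (\<lambda>_. 0)"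
  have zero: "(\<lambda>_. 0) \<in> coord_space n" for n
    by (simp add: coord_space_def)
  show thesis
  proof
    fix i j l
    have "x (i, j, l) = (\<Sum>s<m. u s i * v s j * w s l)"
      by (simp add: x sum_fun_apply)
    also have "\<dots> = (\<Sum>s<r. ?pad u s i * ?pad v s j * ?pad w s l)"
      using m by (intro sum.mono_neutral_cong_left) auto
    finally show "x (i, j, l) = (\<Sum>s<r. ?pad u s i * ?pad v s j * ?pad w s l)" .
  qed (use mem zero m in auto)
qed

lemma sum_unit_vector:
  "(\<Sum>s<n. unit_vector s j * f s) = (if j < n then f j else 0)"
proof -
  have "(\<Sum>s<n. unit_vector s j * f s) = (\<Sum>s<n. if s = j then f s else 0)"
    by (rule sum.cong) (auto simp: unit_vector_def)
  then show ?thesis by simp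
qed

lemma tensor_slice_expansion:
  assumes "T \<in> tensor_space a b c"
  shows "T (i, j, l) = (\<Sum>i'<a. \<Sum>j'<b. unit_vector i' i * unit_vector j' j * T (i', j', l))"
proof -
  have "T (i, j, l) = (\<Sum>i'<a. unit_vector i' i * (\<Sum>j'<b. unit_vector j' j * T (i', j', l)))"
    using assms by (auto simp: sum_unit_vector tensor_space_def)
  then show ?thesis
    by (simp add: sum_distrib_left mult.assoc)
qed

text \<open>Some finite bound is what ensures that the \<open>LEAST\<close> in
  \<open>border_rank\<close> is attained.\<close>

lemma tensor_space_rank_le:
  assumes "T \<in> tensor_space a b c"
  shows "T \<in> rank_le_set a b c (a * b)"
\<comment> \<open>The index pair \<open>(i', j')\<close> is encoded as
  \<open>s = i' * b + j'\<close>.\<close>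
proof (rule rank_le_setI[where m = "a * b" and u = "\<lambda>s. unit_vector (s div b)"
      and v = "\<lambda>s. unit_vector (s mod b)" and w = "\<lambda>s l. T (s div b, s mod b, l)"])
  fix s assume s: "s < a * b"
  then have "0 < b" by (cases b) auto
  then have "s div b < a" "s mod b < b"
    using s by (auto simp: less_mult_imp_div_less)
  then show "unit_vector (s div b) \<in> coord_space a \<and> unit_vector (s mod b) \<in> coord_space b \<and>
      (\<lambda>l. T (s div b, s mod b, l)) \<in> coord_space c"
    using assms by (fastforce simp: unit_vector_def coord_space_def tensor_space_def)
next
  fix i j l
  let ?f = "\<lambda>s. unit_vector (s div b) i * unit_vector (s mod b) j * T (s div b, s mod b, l)"
  have "(\<Sum>s<a * b. ?f s) = (\<Sum>i'<a. \<Sum>s = i' * b..<i' * b + b. ?f s)"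
    by (rule sum.nat_group[symmetric])
  also have "\<dots> = (\<Sum>i'<a. \<Sum>j'<b. unit_vector i' i * unit_vector j' j * T (i', j', l))"
  proof (rule sum.cong[OF refl])
    fix i'
    have "(\<Sum>s = i' * b..<i' * b + b. ?f s) = (\<Sum>j' = 0..<b. ?f (j' + i' * b))"
      using sum.shift_bounds_nat_ivl[of ?f 0 "i' * b" b] by (simp add: add.commute)
    also have "\<dots> = (\<Sum>j'<b. unit_vector i' i * unit_vector j' j * T (i', j', l))"
      by (rule sum.cong) auto
    finally show "(\<Sum>s = i' * b..<i' * b + b. ?f s) =
      (\<Sum>j'<b. unit_vector i' i * unit_vector j' j * T (i', j', l))" .
  qed
  finally show "T (i, j, l) = (\<Sum>s<a * b. ?f s)"
    using tensor_slice_expansion[OF assms] by metis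
qed simp

section \<open>Border rank and minors of the third flattening\<close>

lemma border_rank_le:
  "x \<in> zariski_closure (rank_le_set a b c r) \<Longrightarrow> border_rank a b c x \<le> r"
  unfolding border_rank_def by (rule Least_le)

lemma mem_closure_border_rank:
  assumes "x \<in> tensor_space a b c"
  shows "x \<in> zariski_closure (rank_le_set a b c (border_rank a b c x))"
  unfolding border_rank_def
  by (rule LeastI[of _ "a * b"])
    (use tensor_space_rank_le[OF assms] zariski_closure_superset in blast)

text \<open>For a sum of \<open>r\<close> pure tensors the matrix factors through
  \<open>K^r\<close>, so it is singular; this is a polynomial condition and survives in the
  closure.\<close>

lemma minor_eq_0_if_rank_lt:
  fixes x :: "'a::field tensor3"
  assumes "x \<in> zariski_closure (rank_le_set a b c r)" "r < n"
  shows "det (mat n n (\<lambda>(p, l). x (f p, g p, l))) = 0"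
proof -
  have "det (mat n n (\<lambda>(p, l). y (f p, g p, l))) = 0"
    if mem: "y \<in> rank_le_set a b c r" for y :: "'a tensor3"
  proof -
    obtain u v w where
      y: "\<And>i j l. y (i, j, l) = (\<Sum>s<r. u s i * v s j * w s l)"
      by (rule rank_le_setE[OF mem]) blast
    \<comment> \<open>Both factors are padded to size \<open>n\<close>. The columns of
      \<open>A\<close> from index \<open>r\<close> on are zero, so \<open>unit_vec n r\<close> lies
      in its kernel.\<close>
    define A where "A = mat n n (\<lambda>(p, s). if s < r then u s (f p) * v s (g p) else 0)"
    define B where "B = mat n n (\<lambda>(s, l). w s l)"
    have "mat n n (\<lambda>(p, l). y (f p, g p, l)) = A * B"
    proof (rule eq_matI)
      fix p l assume "p < dim_row (A * B)" "l < dim_col (A * B)"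
      then have pl: "p < n" "l < n" by (auto simp: A_def B_def)
      have "(A * B) $$ (p, l) = (\<Sum>s = 0..<n. (if s < r then u s (f p) * v s (g p) else 0) * w s l)"
        using pl by (simp add: A_def B_def scalar_prod_def)
      also have "\<dots> = (\<Sum>s<r. u s (f p) * v s (g p) * w s l)"
        using \<open>r < n\<close> by (intro sum.mono_neutral_cong_right) auto
      finally show "mat n n (\<lambda>(p, l). y (f p, g p, l)) $$ (p, l) = (A * B) $$ (p, l)"
        using pl by (simp add: y)
    qed (auto simp: A_def B_def)
    moreover have "det A = 0"
    proof -
      have "A *\<^sub>v unit_vec n r = 0\<^sub>v n"
        using \<open>r < n\<close> by (intro eq_vecI) (auto simp: A_def)
      moreover have "unit_vec n r \<noteq> (0\<^sub>v n :: 'a vec)"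
        using \<open>r < n\<close> by simp
      ultimately show ?thesis
        by (subst det_0_iff_vec_prod_zero[of _ n]) (auto simp: A_def intro!: exI[of _ "unit_vec n r"])
    qed
    moreover have "A \<in> carrier_mat n n" "B \<in> carrier_mat n n"
      by (auto simp: A_def B_def)
    ultimately show ?thesis
      by (simp add: det_mult)
  qed
  moreover have "polynomial_fun (\<lambda>x :: 'a tensor3. det (mat n n (\<lambda>(p, l). x (f p, g p, l))))"
    by (rule polynomial_fun_det[where f = "\<lambda>p l. (f p, g p, l)"])
  ultimately show ?thesis
    using assms(1) by (auto simp: zariski_closure_def)
qed

section \<open>Conciseness\<close>

lemma coord_space_subspace: "fun_vs.subspace (coord_space n)"
  by (auto simp: fun_vs.subspace_def coord_space_def fscale_def)

lemma coord_space_subset_span_units: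
  "(coord_space n :: (nat \<Rightarrow> 'a::field) set) \<subseteq> fun_vs.span (unit_vector ` {..<n})"
proof
  fix x :: "nat \<Rightarrow> 'a" assume x: "x \<in> coord_space n"
  have "x = (\<Sum>s<n. fscale (x s) (unit_vector s))"
  proof
    fix i
    show "x i = (\<Sum>s<n. fscale (x s) (unit_vector s)) i"
      using x by (simp add: sum_fun_apply fscale_def mult.commute[of "x _"] sum_unit_vector coord_space_def)
  qed
  also have "\<dots> \<in> fun_vs.span (unit_vector ` {..<n})"
    by (intro fun_vs.span_sum fun_vs.span_scale fun_vs.span_base) auto
  finally show "x \<in> fun_vs.span (unit_vector ` {..<n})" .
qed

text \<open>Otherwise all \<open>c\<close> by \<open>c\<close> minors of the third flattening
  vanish, whereas conciseness forces its rows to span \<open>K^c\<close>.\<close>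

lemma concise_third_le_border_rank:
  fixes T :: "'a::field tensor3"
  assumes T: "T \<in> tensor_space a b c" and "concise a b c T"
  shows "c \<le> border_rank a b c T"
proof (rule ccontr)
  assume "\<not> c \<le> border_rank a b c T"
  then have lt: "border_rank a b c T < c" by simp
  \<comment> \<open>The rows of the flattening span a third factor \<open>V\<close> that suffices to
    contain \<open>T\<close>, so conciseness gives \<open>V = coord_space c\<close>.\<close>
  define row where "row = (\<lambda>(i, j) l. T (i, j, l))"
  define V where "V = fun_vs.span (range row)"
  have V: "V \<subseteq> coord_space c"
    unfolding V_def using T
    by (intro fun_vs.span_minimal coord_space_subspace)
      (fastforce simp: coord_space_def row_def tensor_space_def)
  have "T \<in> tensor_prod (coord_space a) (coord_space b) V"
  proof -
    have "T = (\<Sum>i<a. \<Sum>j<b. pure_tensor (unit_vector i) (unit_vector j) (row (i, j)))"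
    proof (rule ext, clarify)
      fix i j l
      show "T (i, j, l) =
        (\<Sum>i<a. \<Sum>j<b. pure_tensor (unit_vector i) (unit_vector j) (row (i, j))) (i, j, l)"
        by (subst tensor_slice_expansion[OF T]) (simp add: sum_fun_apply row_def)
    qed
    also have "\<dots> \<in> tensor_prod (coord_space a) (coord_space b) V"
      unfolding tensor_prod_def
    proof (intro fun_vs.span_sum fun_vs.span_base)
      fix i j assume "i \<in> {..<a}" "j \<in> {..<b}"
      then have "unit_vector i \<in> coord_space a" "unit_vector j \<in> coord_space b"
        by (auto simp: unit_vector_def coord_space_def)
      moreover have "row (i, j) \<in> V"
        by (auto simp: V_def intro: fun_vs.span_base)
      ultimately show "pure_tensor (unit_vector i) (unit_vector j) (row (i, j))
        \<in> {pure_tensor u v w |u v w. u \<in> coord_space a \<and> v \<in> coord_space b \<and> w \<in> V}"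
        by blast
    qed
    finally show ?thesis .
  qed
  moreover have "fun_vs.subspace V"
    by (simp add: V_def)
  ultimately have V_eq: "V = coord_space c"
    using \<open>concise a b c T\<close> V coord_space_subspace unfolding concise_def by blast
  obtain B where B: "B \<subseteq> range row" "fun_vs.independent B" "range row \<subseteq> fun_vs.span B"
    using fun_vs.maximal_independent_subset[of "range row"] by blast
  have span_B: "coord_space c \<subseteq> fun_vs.span B"
    using fun_vs.span_minimal[OF B(3) fun_vs.subspace_span] V_eq by (simp add: V_def)
  have "B \<subseteq> fun_vs.span (unit_vector ` {..<c})"
    using B(1) V V_def fun_vs.span_superset coord_space_subset_span_units by blast
  then have B_fin: "finite B" "card B \<le> card (unit_vector ` {..<c} :: (nat \<Rightarrow> 'a) set)"
    using fun_vs.independent_span_bound[OF _ B(2)] by blast+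
  have B_card: "card B \<le> c"
    using B_fin(2) card_image_le[of "{..<c}" "unit_vector :: nat \<Rightarrow> nat \<Rightarrow> 'a"] by simp
  obtain h where h: "bij_betw h {0..<card B} B"
    using ex_bij_betw_nat_finite[OF B_fin(1)] by blast
  \<comment> \<open>\<open>g p\<close> is an index pair whose row is the \<open>p\<close>-th basis
    vector. For \<open>p \<ge> card B\<close> the pair is arbitrary, which is harmless because every
    minor of size \<open>c\<close> vanishes.\<close>
  define g where "g = (\<lambda>p. inv_into UNIV row (h p))"
  have g: "row (g p) = h p" if "p < card B" for p
    unfolding g_def using that h B(1) by (intro f_inv_into_f) (auto simp: bij_betw_def)
  define M where "M = mat c c (\<lambda>(p, l). T (fst (g p), snd (g p), l))"
  have "det M = 0"
    unfolding M_def by (rule minor_eq_0_if_rank_lt[OF mem_closure_border_rank[OF T] lt])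
  then obtain v where v: "v \<in> carrier_vec c" "v \<noteq> 0\<^sub>v c" "M *\<^sub>v v = 0\<^sub>v c"
    using det_0_iff_vec_prod_zero[of M c] by (auto simp: M_def)
  \<comment> \<open>The kernel of the functional given by \<open>v\<close>. It contains
    \<open>B\<close>, hence all of \<open>K^c\<close>, and evaluation at unit vectors then forces
    \<open>v = 0\<close>.\<close>
  define K where "K = {x :: nat \<Rightarrow> 'a. (\<Sum>l = 0..<c. x l * v $ l) = 0}"
  have "fun_vs.subspace K"
    by (auto simp: K_def fun_vs.subspace_def fscale_def algebra_simps sum.distrib
        sum_distrib_left[symmetric])
  moreover have "B \<subseteq> K"
  proof
    fix x assume "x \<in> B"
    then obtain p where p: "p < card B" "x = row (g p)"
      using h g by (force simp: bij_betw_def)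
    then have "p < c" using B_card by simp
    have "0 = (M *\<^sub>v v) $ p" using v(3) \<open>p < c\<close> by simp
    also have "\<dots> = (\<Sum>l = 0..<c. x l * v $ l)"
      using v(1) \<open>p < c\<close> by (auto simp: M_def scalar_prod_def p(2) row_def case_prod_beta)
    finally show "x \<in> K" by (simp add: K_def)
  qed
  ultimately have "coord_space c \<subseteq> K"
    using span_B fun_vs.span_minimal by blast
  have "v $ q = 0" if "q < c" for q
  proof -
    have "unit_vector q \<in> K"
      using \<open>coord_space c \<subseteq> K\<close> that by (auto simp: coord_space_def unit_vector_def)
    then have "0 = (\<Sum>l = 0..<c. unit_vector q l * v $ l)"
      by (simp add: K_def)
    also have "\<dots> = (\<Sum>l<c. unit_vector l q * v $ l)"
      by (rule sum.cong) (auto simp: unit_vector_def)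
    also have "\<dots> = v $ q" using that by (simp add: sum_unit_vector)
    finally show ?thesis by simp
  qed
  then show False
    using v(1,2) by (metis eq_vecI carrier_vecD index_zero_vec(1) index_zero_vec(2))
qed

section \<open>The tensors $T'_k$\<close>

lemma T_prime_apply:
  "T_prime b c k T (i, j, l) =
    (if 1 \<le> i \<and> b + k - c \<le> l then T (i - 1, j, l - (b + k - c)) else 0) +
    (if i = 0 \<and> j = l \<and> l < b + k then 1 else 0)"
proof -
  have "(\<Sum>s<b + k. unit_vector 0 i * unit_vector s j * unit_vector s l) =
    (\<Sum>s<b + k. unit_vector s j * (unit_vector 0 i * unit_vector s l))"
    by (simp add: mult_ac)
  also have "\<dots> = (if i = 0 \<and> j = l \<and> l < b + k then 1 else 0)"
    unfolding sum_unit_vector by (auto simp: unit_vector_def)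
  finally show ?thesis
    by (simp add: T_prime_def embed_tensor_def sum_fun_apply)
qed

lemma T_prime_tensor_space:
  assumes "T \<in> tensor_space a b c" "c \<le> k"
  shows "T_prime b c k T \<in> tensor_space (a + 1) (b + k) (b + k)"
  unfolding tensor_space_def
proof (intro CollectI allI impI)
  fix i j l assume nz: "T_prime b c k T (i, j, l) \<noteq> 0"
  show "i < a + 1 \<and> j < b + k \<and> l < b + k"
  proof (cases "1 \<le> i \<and> b + k - c \<le> l \<and> T (i - 1, j, l - (b + k - c)) \<noteq> 0")
    case True
    then have "i - 1 < a" "j < b" "l - (b + k - c) < c"
      using assms(1) by (auto simp: tensor_space_def)
    then show ?thesis using True \<open>c \<le> k\<close> by linarith
  next
    case False
    then show ?thesis using nz by (auto simp: T_prime_apply split: if_splits)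
  qed
qed

lemma border_rank_T_prime_ge:
  assumes "T \<in> tensor_space a b c" "c \<le> k"
  shows "b + k \<le> border_rank (a + 1) (b + k) (b + k) (T_prime b c k T)"
proof (rule ccontr)
  let ?n = "b + k"
  assume "\<not> ?n \<le> border_rank (a + 1) ?n ?n (T_prime b c k T)"
  then have "det (mat ?n ?n (\<lambda>(p, l). T_prime b c k T (0, p, l))) = 0"
    using minor_eq_0_if_rank_lt[OF mem_closure_border_rank[OF T_prime_tensor_space[OF assms]],
        of ?n "\<lambda>_. 0" "\<lambda>p. p"] by simp
  moreover have "mat ?n ?n (\<lambda>(p, l). T_prime b c k T (0, p, l)) = 1\<^sub>m ?n"
    by (rule eq_matI) (auto simp: T_prime_apply)
  ultimately show False by simp
qed

lemma border_rank_le_of_T_prime: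
  fixes T :: "'a::field tensor3"
  assumes T: "T \<in> tensor_space a b c" and "c \<le> k"
    and T': "T_prime b c k T \<in> zariski_closure (rank_le_set (a + 1) (b + k) (b + k) r)"
  shows "T \<in> zariski_closure (rank_le_set a b c r)"
proof -
  \<comment> \<open>\<open>\<phi>\<close> undoes the shifts of \<open>embed_tensor\<close> and reads
    only first indices at least 1, thus missing the identity part. It maps pure tensors to pure
    tensors.\<close>
  define \<phi> :: "'a tensor3 \<Rightarrow> 'a tensor3" where
    "\<phi> = (\<lambda>x (i, j, l). if i < a \<and> j < b \<and> l < c then x (i + 1, j, l + (b + k - c)) else 0)"
  have "\<phi> (T_prime b c k T) = T"
    using T by (auto simp: \<phi>_def fun_eq_iff T_prime_apply tensor_space_def)
  moreover have "\<phi> (T_prime b c k T) \<in> zariski_closure (rank_le_set a b c r)"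
  proof (rule zariski_closure_polynomial_map[OF _ _ T'])
    show "polynomial_fun (\<lambda>x. \<phi> x i)" for i
      by (cases i) (auto simp: \<phi>_def intro!: polynomial_fun_if polynomial_fun.intros)
  next
    fix x :: "'a tensor3" assume "x \<in> rank_le_set (a + 1) (b + k) (b + k) r"
    then obtain u v w where x: "\<And>i j l. x (i, j, l) = (\<Sum>s<r. u s i * v s j * w s l)"
      by (rule rank_le_setE) blast
    have "\<phi> x \<in> rank_le_set a b c r"
      by (rule rank_le_setI[where m = r and u = "\<lambda>s i. if i < a then u s (i + 1) else 0"
            and v = "\<lambda>s j. if j < b then v s j else 0"
            and w = "\<lambda>s l. if l < c then w s (l + (b + k - c)) else 0"])
        (auto simp: coord_space_def \<phi>_def x)
    then show "\<phi> x \<in> zariski_closure (rank_le_set a b c r)"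
      using zariski_closure_superset by blast
  qed
  ultimately show ?thesis by simp
qed

section \<open>Degenerations bounding the border rank of \<open>T'_k\<close> from above\<close>

text \<open>The determinant of \<open>t I + W\<close> is the characteristic polynomial of
  \<open>- W\<close> at \<open>t\<close>, which is monic and so has finitely many roots. The vectors
  \<open>D s\<close> form the basis dual to the rows of \<open>t I + W\<close>.\<close>

lemma cofinite_left_inverse:
  fixes W :: "nat \<Rightarrow> nat \<Rightarrow> 'k::field"
  shows "\<exists>F. finite F \<and> (\<forall>t. t \<notin> F \<longrightarrow> (\<exists>D. \<forall>p<n. \<forall>l<n.
    (\<Sum>s<n. D s p * ((if s = l then t else 0) + W s l)) = (if p = l then 1 else 0)))"
proof -
  define A where "A = mat n n (\<lambda>(s, l). - W s l)"
  have A: "A \<in> carrier_mat n n" by (simp add: A_def)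
  define F where "F = {t. poly (char_poly A) t = 0}"
  have "char_poly A \<noteq> 0"
    using degree_monic_char_poly[OF A] by auto
  then have "finite F"
    unfolding F_def by (rule poly_roots_finite)
  moreover have "\<exists>D. \<forall>p<n. \<forall>l<n.
    (\<Sum>s<n. D s p * ((if s = l then t else 0) + W s l)) = (if p = l then 1 else 0)" if "t \<notin> F" for t
  proof -
    \<comment> \<open>\<open>char_matrix A t\<close> is \<open>A - t I\<close>, so \<open>M\<close>
      is \<open>t I + W\<close>.\<close>
    define M where "M = - char_matrix A t"
    have M: "M \<in> carrier_mat n n" using A by (simp add: M_def)
    have M_apply: "M $$ (s, l) = (if s = l then t else 0) + W s l" if "s < n" "l < n" for s l
      using that by (auto simp: M_def A_def char_matrix_def)
    have det: "det M \<noteq> 0"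
      using that char_poly_matrix[OF A] by (simp add: F_def M_def)
    have "(\<Sum>s<n. adj_mat M $$ (p, s) / det M * ((if s = l then t else 0) + W s l)) =
      (if p = l then 1 else 0)" if pl: "p < n" "l < n" for p l
    proof -
      have "(\<Sum>s<n. adj_mat M $$ (p, s) * ((if s = l then t else 0) + W s l)) = (adj_mat M * M) $$ (p, l)"
        using pl M adj_mat(1)[OF M]
        by (auto simp: scalar_prod_def M_apply atLeast0LessThan intro!: sum.cong)
      also have "\<dots> = (if p = l then det M else 0)"
        using pl by (simp add: adj_mat(3)[OF M])
      finally show ?thesis
        using det by (simp add: sum_divide_distrib[symmetric])
    qed
    then show ?thesis
      by (intro exI[of _ "\<lambda>s p. adj_mat M $$ (p, s) / det M"]) auto
  qed
  ultimately show ?thesis by blast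
qed

text \<open>
  For dual bases \<open>D\<close> and \<open>W\<close>, the tensors
  \<open>(e\<^sub>0 + \<epsilon> u\<^sub>s) \<otimes> (D\<^sub>s + \<epsilon>\<^sup>-\<^sup>1 v\<^sub>s) \<otimes> W\<^sub>s\<close> sum up to the required tensor, up to a term of order
  \<open>\<epsilon>\<close> and to \<open>e\<^sub>0 \<otimes> (\<epsilon>\<^sup>-\<^sup>1 \<Sum> v\<^sub>s \<otimes> W\<^sub>s - \<Sum> f\<^sub>j \<otimes> f\<^sub>j)\<close>, which is cancelled by \<open>b\<close> rank one terms.
\<close>

lemma identity_plus_block_mem_closure:
  fixes u v W D :: "nat \<Rightarrow> nat \<Rightarrow> 'k::field_char_0"
  assumes u: "\<And>s. u s \<in> coord_space a" and v: "\<And>s. v s \<in> coord_space b"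
    and DW: "\<And>p l. p < k \<Longrightarrow> l < k \<Longrightarrow> (\<Sum>s<k. D s p * W s l) = (if p = l then 1 else 0)"
  shows "(\<lambda>(i, j, l).
      (if 1 \<le> i \<and> j < b \<and> b \<le> l \<and> l < b + k then \<Sum>s<k. u s (i - 1) * v s j * W s (l - b) else 0) +
      (if i = 0 \<and> j = l \<and> l < b + k then 1 else 0))
    \<in> zariski_closure (rank_le_set (a + 1) (b + k) (b + k) (b + k))" (is "?S \<in> _")
proof (rule zariski_closure_line[where F = "{0}"])
  fix \<epsilon> :: 'k assume "\<epsilon> \<notin> {0}"
  then have \<epsilon>: "\<epsilon> \<noteq> 0" by simp
  \<comment> \<open>The term of order \<open>\<epsilon>\<close> in the expansion, built from
    \<open>u s\<close>, \<open>D s\<close> and \<open>W s\<close>.\<close>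
  let ?R = "\<lambda>(i, j, l). if 1 \<le> i \<and> b \<le> j \<and> j < b + k \<and> b \<le> l \<and> l < b + k
    then \<Sum>s<k. u s (i - 1) * D s (j - b) * W s (l - b) else 0"
  \<comment> \<open>\<open>W'\<close> puts \<open>W s\<close> into the last \<open>k\<close>
    coordinates. The indices \<open>s < b\<close> carry the correcting terms with first factor
    \<open>e_0\<close>; the remaining \<open>k\<close> carry the degenerating summands.\<close>
  define W' where "W' = (\<lambda>s l. if b \<le> l \<and> l < b + k then W s (l - b) else 0)"
  define U where "U = (\<lambda>s i. if i = 0 then 1 else if s < b then 0 else \<epsilon> * u (s - b) (i - 1))"
  define V where "V = (\<lambda>s j. if s < b then unit_vector s j
    else if j < b then v (s - b) j / \<epsilon> else if j < b + k then D (s - b) (j - b) else 0)"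
  define Z where "Z = (\<lambda>s l. if s < b then unit_vector s l - (\<Sum>q<k. v q s / \<epsilon> * W' q l) else W' (s - b) l)"
  have vanish: "u s i = 0" if "a \<le> i" for s i
    using u[of s] that by (simp add: coord_space_def)
  have sum_split: "(\<Sum>s<b + k. f s) = (\<Sum>s<b. f s) + (\<Sum>s<k. f (b + s))" for f :: "nat \<Rightarrow> 'k"
    by (induction k) (auto simp: add.assoc)
  have "(\<lambda>x. ?S x + \<epsilon> * ?R x) \<in> rank_le_set (a + 1) (b + k) (b + k) (b + k)"
  proof (rule rank_le_setI[where m = "b + k" and u = U and v = V and w = Z])
    fix s assume "s < b + k"
    then show "U s \<in> coord_space (a + 1) \<and> V s \<in> coord_space (b + k) \<and> Z s \<in> coord_space (b + k)"
      by (auto simp: coord_space_def U_def V_def Z_def W'_def unit_vector_def vanish)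
  next
    fix i j l
    have 1: "(\<Sum>s<b. U s i * V s j * Z s l) =
      (if i = 0 \<and> j < b then unit_vector j l - (\<Sum>q<k. v q j / \<epsilon> * W' q l) else 0)"
    proof -
      have "(\<Sum>s<b. U s i * V s j * Z s l) = (\<Sum>s<b. unit_vector s j * (if i = 0 then
          unit_vector s l - (\<Sum>q<k. v q s / \<epsilon> * W' q l) else 0))"
        by (rule sum.cong) (auto simp: U_def V_def Z_def)
      then show ?thesis by (auto simp: sum_unit_vector)
    qed
    have 2: "(\<Sum>s<k. U (b + s) i * V (b + s) j * Z (b + s) l) =
      (\<Sum>s<k. (if i = 0 then 1 else \<epsilon> * u s (i - 1)) *
        (if j < b then v s j / \<epsilon> else if j < b + k then D s (j - b) else 0) * W' s l)"
      by (rule sum.cong) (auto simp: U_def V_def Z_def)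
    have "?S (i, j, l) + \<epsilon> * ?R (i, j, l) =
        (if i = 0 \<and> j < b then unit_vector j l - (\<Sum>q<k. v q j / \<epsilon> * W' q l) else 0) +
        (\<Sum>s<k. (if i = 0 then 1 else \<epsilon> * u s (i - 1)) *
        (if j < b then v s j / \<epsilon> else if j < b + k then D s (j - b) else 0) * W' s l)"
    \<comment> \<open>In the slice \<open>i = 0\<close> the \<open>1 / \<epsilon>\<close> terms
      cancel for \<open>j < b\<close>, and duality of \<open>D\<close> and \<open>W\<close> gives
      the identity block for \<open>j \<ge> b\<close>. In the other slices the factors
      \<open>\<epsilon>\<close> and \<open>1 / \<epsilon>\<close> cancel for \<open>j < b\<close>,
      and \<open>j \<ge> b\<close> gives the error term.\<close>
    proof (cases "i = 0")
      case i: True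
      show ?thesis
      proof (cases "j < b")
        case True
        then show ?thesis using i by (auto simp: unit_vector_def)
      next
        case j: False
        show ?thesis
        proof (cases "j < b + k \<and> b \<le> l \<and> l < b + k")
          case True
          then have "(\<Sum>s<k. D s (j - b) * W s (l - b)) = (if j = l then 1 else 0)"
            using j DW[of "j - b" "l - b"] by (auto simp: eq_diff_iff)
          then show ?thesis using i j True by (auto simp: W'_def)
        next
          case False
          then show ?thesis using i j by (auto simp: W'_def)
        qed
      qed
    next
      case i: False
      then show ?thesis using \<epsilon>
        by (auto simp: W'_def sum_distrib_left mult.assoc intro!: sum.cong)
    qed
    also have "\<dots> = (\<Sum>s<b + k. U s i * V s j * Z s l)"
      unfolding sum_split 1 2 ..
    finally show "?S (i, j, l) + \<epsilon> * ?R (i, j, l) = (\<Sum>s<b + k. U s i * V s j * Z s l)" .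
  qed simp
  then show "(\<lambda>x. ?S x + \<epsilon> * ?R x) \<in> zariski_closure (rank_le_set (a + 1) (b + k) (b + k) (b + k))"
    using zariski_closure_superset by blast
qed simp

text \<open>The number of summands equals the number \<open>k\<close> of added dimensions, so the
  third factors are \<open>k\<close> vectors in \<open>K^k\<close> and can be perturbed to a
  basis.\<close>

lemma T_prime_rank_le:
  fixes T :: "'k::field_char_0 tensor3"
  assumes "T \<in> rank_le_set a b c k" "c \<le> k"
  shows "T_prime b c k T \<in> zariski_closure (rank_le_set (a + 1) (b + k) (b + k) (b + k))"
proof -
  obtain u v w where u: "\<And>s. u s \<in> coord_space a" and v: "\<And>s. v s \<in> coord_space b"
    and w: "\<And>s. w s \<in> coord_space c"
    and T: "\<And>i j l. T (i, j, l) = (\<Sum>s<k. u s i * v s j * w s l)"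
    using assms(1) by (rule rank_le_setE) blast
  have v0: "v s j = 0" if "b \<le> j" for s j
    using v[of s] that by (simp add: coord_space_def)
  have w0: "w s l = 0" if "c \<le> l" for s l
    using w[of s] that by (simp add: coord_space_def)
  \<comment> \<open>The last \<open>c\<close> coordinates of \<open>K^k\<close> become the last
    \<open>c\<close> of \<open>K^(b+k)\<close> after the shift by \<open>b\<close>, matching
    \<open>embed_tensor\<close>.\<close>
  define W where "W = (\<lambda>s l. if k - c \<le> l then w s (l - (k - c)) else 0)"
  obtain F where F: "finite F" "\<And>t. t \<notin> F \<Longrightarrow> \<exists>D. \<forall>p<k. \<forall>l<k.
      (\<Sum>s<k. D s p * ((if s = l then t else 0) + W s l)) = (if p = l then 1 else 0)"
    using cofinite_left_inverse[of k W] by blast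
  let ?R = "\<lambda>(i, j, l). if 1 \<le> i \<and> j < b \<and> b \<le> l \<and> l < b + k then u (l - b) (i - 1) * v (l - b) j else 0"
  \<comment> \<open>Replacing \<open>W\<close> by \<open>W + t I\<close> makes it invertible for almost all \<open>t\<close>; the tensor changes by \<open>t\<close> times \<open>?R\<close>.\<close>
  show ?thesis
  proof (rule zariski_closure_line[OF F(1)])
    fix t assume "t \<notin> F"
    define Wt where "Wt = (\<lambda>s l. (if s = l then t else 0) + W s l)"
    obtain D where D: "\<And>p l. p < k \<Longrightarrow> l < k \<Longrightarrow> (\<Sum>s<k. D s p * Wt s l) = (if p = l then 1 else 0)"
      using F(2)[OF \<open>t \<notin> F\<close>] unfolding Wt_def by blast
    have "T_prime b c k T (i, j, l) + t * ?R (i, j, l) =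
      (if 1 \<le> i \<and> j < b \<and> b \<le> l \<and> l < b + k then \<Sum>s<k. u s (i - 1) * v s j * Wt s (l - b) else 0) +
      (if i = 0 \<and> j = l \<and> l < b + k then 1 else 0)" for i j l
    proof (cases "1 \<le> i \<and> j < b \<and> b \<le> l \<and> l < b + k")
      case True
      have "(\<Sum>s<k. u s (i - 1) * v s j * Wt s (l - b)) =
        (\<Sum>s<k. if s = l - b then t * (u s (i - 1) * v s j) else 0) + (\<Sum>s<k. u s (i - 1) * v s j * W s (l - b))"
        unfolding sum.distrib[symmetric] by (rule sum.cong) (auto simp: Wt_def algebra_simps)
      also have "\<dots> = t * (u (l - b) (i - 1) * v (l - b) j) + (\<Sum>s<k. u s (i - 1) * v s j * W s (l - b))"
        using True by auto
      also have "(\<Sum>s<k. u s (i - 1) * v s j * W s (l - b)) =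
        (if b + k - c \<le> l then T (i - 1, j, l - (b + k - c)) else 0)"
      proof -
        have "k - c \<le> l - b \<longleftrightarrow> b + k - c \<le> l" "l - b - (k - c) = l - (b + k - c)"
          using True \<open>c \<le> k\<close> by auto
        then show ?thesis by (simp add: W_def T)
      qed
      finally show ?thesis using True by (auto simp: T_prime_apply)
    next
      case False
      \<comment> \<open>Since \<open>c \<le> k\<close> gives \<open>b \<le> l\<close>, either
        \<open>j \<ge> b\<close>, where \<open>v\<close> vanishes, or \<open>l \<ge> b + k\<close>,
        where \<open>w\<close> vanishes.\<close>
      have "T (i - 1, j, l - (b + k - c)) = 0" if "1 \<le> i" "b + k - c \<le> l"
        using that False \<open>c \<le> k\<close> by (cases "j < b") (auto simp: T v0 w0)
      then show ?thesis using False by (auto simp: T_prime_apply)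
    qed
    then have "(\<lambda>x. T_prime b c k T x + t * ?R x) = (\<lambda>(i, j, l).
      (if 1 \<le> i \<and> j < b \<and> b \<le> l \<and> l < b + k then \<Sum>s<k. u s (i - 1) * v s j * Wt s (l - b) else 0) +
      (if i = 0 \<and> j = l \<and> l < b + k then 1 else 0))"
      by (auto simp: fun_eq_iff)
    also have "\<dots> \<in> zariski_closure (rank_le_set (a + 1) (b + k) (b + k) (b + k))"
      by (rule identity_plus_block_mem_closure[OF u v D])
    finally show "(\<lambda>x. T_prime b c k T x + t * ?R x) \<in> zariski_closure (rank_le_set (a + 1) (b + k) (b + k) (b + k))" .
  qed
qed

text \<open>The coordinates of \<open>T'_k\<close> are affine in those of \<open>T\<close>, so the
  bound extends from tensors of rank at most \<open>k\<close> to their closure.\<close>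

lemma T_prime_border_rank_le:
  fixes T :: "'k::field_char_0 tensor3"
  assumes "T \<in> zariski_closure (rank_le_set a b c k)" "c \<le> k"
  shows "T_prime b c k T \<in> zariski_closure (rank_le_set (a + 1) (b + k) (b + k) (b + k))"
proof (rule zariski_closure_polynomial_map[OF _ _ assms(1)])
  show "polynomial_fun (\<lambda>T :: 'k tensor3. T_prime b c k T x)" for x
    by (cases x) (auto simp: T_prime_apply intro!: polynomial_fun_if polynomial_fun.intros)
qed (rule T_prime_rank_le[OF _ assms(2)])

theorem corollary5p15:
  fixes T :: "'k::{alg_closed_field, field_char_0} tensor3" and a b c :: nat
  assumes "T \<in> tensor_space a b c"
    and "concise a b c T"
  shows "(\<exists>k\<ge>c. border_rank (a + 1) (b + k) (b + k) (T_prime b c k T) = b + k) \<and>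
    (let k = (LEAST k. k \<ge> c \<and> border_rank (a + 1) (b + k) (b + k) (T_prime b c k T) = b + k)
     in k \<le> border_rank a b c T \<and> border_rank a b c T \<le> b + k)"
proof -
  let ?r = "border_rank a b c T"
  let ?P = "\<lambda>k. k \<ge> c \<and> border_rank (a + 1) (b + k) (b + k) (T_prime b c k T) = b + k"
  have "c \<le> ?r"
    by (rule concise_third_le_border_rank[OF assms])
  \<comment> \<open>The border rank of \<open>T\<close> is itself an admissible \<open>k\<close>,
    which gives existence and bounds the least one.\<close>
  then have r: "?P ?r"
    using border_rank_T_prime_ge[OF assms(1)]
      border_rank_le[OF T_prime_border_rank_le[OF mem_closure_border_rank[OF assms(1)]]]
    by (simp add: antisym)
  have upper: "?r \<le> b + k" if "?P k" for k
    using border_rank_le[OF border_rank_le_of_T_prime[OF assms(1) _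
        mem_closure_border_rank[OF T_prime_tensor_space[OF assms(1)]], of k]] that by simp
  show ?thesis
    using r upper[OF LeastI[of ?P, OF r]] Least_le[of ?P, OF r] by (auto simp: Let_def)
qed

end
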